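(* Let $(X_i)_{i\ge1}$ be identically distributed random variables on a probability space with $\mathbf{E}X_i=\mu$ and $\mathbf{E}X_i^2<\infty$, and let $S_n=\sum_{i=1}^n X_i$. Suppose that $X_i\ge -M$ for all $i$, for some constant $M>0$, and that there exists $\gamma>1$ such that, as $n\to\infty$, \[ \sum_{1\le i<j\le n}\bigl(\mathbf{E}(X_iX_j)-\mu^2\bigr)=O\left(\frac{n^2}{(\log n)\,(\log\log n)^{\gamma}}\right). \] Then \[ \frac{S_n}{n}\to\mu\quad\text{almost surely.} \]
   Context: $\mathbf{E}$ denotes expectation. No independence of the $X_i$ is assumed. *)

theory Defs
  imports "HOL-Probability.Probability" "HOL-Library.Landau_Symbols"
begin

end

theory Submission
  imports Defs "HOL-Real_Asymp.Real_Asymp"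
begin

text \<open>
  For \<open>q > 1\<close> and \<open>a k = \<lceil>q ^ k\<rceil>\<close>, the covariance bound makes the variances of
  \<open>S (a k) / a k\<close> of order \<open>q powr (-k) + 1 / (k * (ln k) powr \<gamma>)\<close>, which is summable;
  hence \<open>S (a k) / a k\<close> tends to \<open>\<mu>\<close> almost surely. Since \<open>X i + M \<ge> 0\<close>, the sums
  \<open>S n + n * M\<close> increase in \<open>n\<close>, so between \<open>a k\<close> and \<open>a (k + 1)\<close> their averages are
  controlled up to a factor that tends to \<open>q\<close>; finally \<open>q\<close> tends to 1 along a sequence.
\<close>

section \<open>Expanding the square of a finite sum\<close>

lemma sum_strict_pairs_Suc:
  fixes f :: "nat \<Rightarrow> nat \<Rightarrow> 'a::comm_monoid_add"
  shows "(\<Sum>(i, j) \<in> {(i, j). 1 \<le> i \<and> i < j \<and> j \<le> Suc n}. f i j)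
    = (\<Sum>(i, j) \<in> {(i, j). 1 \<le> i \<and> i < j \<and> j \<le> n}. f i j) + (\<Sum>i = 1..n. f i (Suc n))"
proof -
  let ?D = "\<lambda>n. {(i, j). (1::nat) \<le> i \<and> i < j \<and> j \<le> n}"
  have split: "?D (Suc n) = ?D n \<union> (\<lambda>i. (i, Suc n)) ` {1..n}"
    by (auto simp: le_Suc_eq)
  have "finite (?D n)"
    by (rule finite_subset[of _ "{..n} \<times> {..n}"]) auto
  then show ?thesis
    unfolding split by (subst sum.union_disjoint) (auto simp: sum.reindex inj_on_def)
qed

text \<open>The off-diagonal terms are collected over the same index set as in the covariance
  hypothesis, so that after centring their expectation is exactly the quantity bounded
  there.\<close>

lemma square_sum_eq_strict_pairs:
  fixes y :: "nat \<Rightarrow> 'a::comm_ring_1"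
  shows "(\<Sum>i = 1..n. y i)\<^sup>2
    = (\<Sum>i = 1..n. (y i)\<^sup>2) + 2 * (\<Sum>(i, j) \<in> {(i, j). 1 \<le> i \<and> i < j \<and> j \<le> n}. y i * y j)"
proof (induction n)
  case 0
  have "{(i, j). (1::nat) \<le> i \<and> i < j \<and> j \<le> 0} = {}" by auto
  then show ?case by (simp only: sum.empty) simp
next
  case (Suc n)
  show ?case
    unfolding sum_strict_pairs_Suc
    using Suc by (simp add: power2_sum sum_distrib_left sum_distrib_right algebra_simps)
qed

section \<open>A convergent logarithmic series and almost sure convergence\<close>

text \<open>
  The shift in \<open>ln (k + 1)\<close> makes the terms decrease from \<open>k = 1\<close> on, as condensation
  requires; at \<open>k = 1\<close> the unshifted term would be \<open>1 / 0 = 0\<close>.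
\<close>
lemma summable_inverse_mult_ln_powr:
  fixes \<gamma> :: real
  assumes "\<gamma> > 1"
  shows "summable (\<lambda>k. 1 / (real k * ln (real k + 1) powr \<gamma>))"
proof -
  let ?f = "\<lambda>k. 1 / (real k * ln (real k + 1) powr \<gamma>)"
  have "summable ?f \<longleftrightarrow> summable (\<lambda>n. 2 ^ n * ?f (2 ^ n))"
    using assms
    by (intro condensation_test) (auto intro!: divide_left_mono mult_mono powr_mono2 mult_pos_pos)
  \<comment> \<open>The weight \<open>2 ^ n\<close> cancels the linear factor. What remains is of
    order \<open>n powr - \<gamma>\<close>, since \<open>ln (2 ^ n + 1)\<close> grows like
    \<open>n * ln 2\<close>.\<close>
  also have "(\<lambda>n. 2 ^ n * ?f (2 ^ n)) = (\<lambda>n. 1 / ln (2 ^ n + 1) powr \<gamma>)"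
    by (simp add: fun_eq_iff)
  also have "summable \<dots>"
  proof (rule summable_comparison_test_bigo)
    show "summable (\<lambda>n. norm (real n powr - \<gamma>))"
      using assms by (simp add: summable_real_powr_iff)
    show "(\<lambda>n. 1 / ln (2 ^ n + 1) powr \<gamma>) \<in> O(\<lambda>n. real n powr - \<gamma>)"
      using assms by real_asymp
  qed
  finally show ?thesis .
qed

text \<open>By monotone convergence the series of the \<open>f k\<close> has finite integral, so it
  is finite almost everywhere, and the terms of a convergent series tend to 0. This does the work of
  Chebyshev and Borel-Cantelli in one stroke.\<close>

lemma (in finite_measure) AE_tendsto_0_of_summable_integral:
  fixes f :: "nat \<Rightarrow> 'a \<Rightarrow> real"
  assumes "\<And>k. integrable M (f k)" and "\<And>k x. 0 \<le> f k x"
    and "summable (\<lambda>k. \<integral>x. f k x \<partial>M)"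
  shows "AE x in M. (\<lambda>k. f k x) \<longlonglongrightarrow> 0"
proof -
  have [measurable]: "f k \<in> borel_measurable M" for k
    using assms(1) by simp
  have "(\<integral>\<^sup>+x. (\<Sum>k. ennreal (f k x)) \<partial>M) = (\<Sum>k. ennreal (\<integral>x. f k x \<partial>M))"
    using assms by (simp add: nn_integral_suminf nn_integral_eq_integral)
  also have "\<dots> \<noteq> \<infinity>"
    using assms by (simp add: suminf_ennreal_eq[OF _ summable_sums])
  finally have "AE x in M. (\<Sum>k. ennreal (f k x)) \<noteq> \<infinity>"
    by (intro nn_integral_PInf_AE) auto
  then show ?thesis
    by eventually_elim (auto intro!: summable_LIMSEQ_zero summable_suminf_not_top assms)
qed

section \<open>Averages of monotone sequences along rounded geometric subsequences\<close>

context
  fixes q :: real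
  assumes q: "q > 1"
begin

lemma ratio_ceiling_power_tendsto:
  "(\<lambda>k. real (nat \<lceil>q ^ Suc k\<rceil>) / real (nat \<lceil>q ^ k\<rceil>)) \<longlonglongrightarrow> q"
proof (rule real_tendsto_sandwich)
  have pos: "q ^ k > 0" for k using q by simp
  have le: "q ^ k \<le> real (nat \<lceil>q ^ k\<rceil>)" for k by linarith
  have ge: "real (nat \<lceil>q ^ k\<rceil>) \<le> q ^ k + 1" for k using pos[of k] by linarith
  have posc: "0 < real (nat \<lceil>q ^ k\<rceil>)" for k using pos[of k] by simp
  show "\<forall>\<^sub>F k in sequentially. q ^ Suc k / (q ^ k + 1) \<le> real (nat \<lceil>q ^ Suc k\<rceil>) / real (nat \<lceil>q ^ k\<rceil>)"
    by (intro always_eventually allI frac_le le ge posc) simp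
  show "\<forall>\<^sub>F k in sequentially. real (nat \<lceil>q ^ Suc k\<rceil>) / real (nat \<lceil>q ^ k\<rceil>) \<le> (q ^ Suc k + 1) / q ^ k"
    by (intro always_eventually allI frac_le le ge pos add_nonneg_nonneg less_imp_le[OF pos]) simp
  show "(\<lambda>k. q ^ Suc k / (q ^ k + 1)) \<longlonglongrightarrow> q" using q by real_asymp (simp add: exp_minus)
  show "(\<lambda>k. (q ^ Suc k + 1) / q ^ k) \<longlonglongrightarrow> q" using q by real_asymp (simp add: exp_minus)
qed

text \<open>The witness is the integer part of \<open>log q n\<close>. Rounding up keeps both
  inequalities because \<open>n\<close> is itself an integer.\<close>

lemma exists_power_bracket:
  obtains \<kappa> :: "nat \<Rightarrow> nat" where "filterlim \<kappa> at_top at_top"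
    and "\<And>n. n > 0 \<Longrightarrow> nat \<lceil>q ^ \<kappa> n\<rceil> \<le> n" and "\<And>n. n > 0 \<Longrightarrow> n \<le> nat \<lceil>q ^ Suc (\<kappa> n)\<rceil>"
proof
  define \<kappa> where "\<kappa> n = nat \<lfloor>log q (real n)\<rfloor>" for n
  show "filterlim \<kappa> at_top at_top"
    unfolding \<kappa>_def using q by real_asymp
  fix n :: nat assume n: "n > 0"
  \<comment> \<open>Nonnegativity ensures that \<open>nat\<close> does not truncate the
    floor.\<close>
  have "0 \<le> log q (real n)" using n q by simp
  then have *: "real (\<kappa> n) \<le> log q (real n)" "log q (real n) \<le> real (Suc (\<kappa> n))"
    unfolding \<kappa>_def by linarith+
  have "q ^ \<kappa> n \<le> real n"
    using *(1) n q by (simp add: le_log_iff powr_realpow)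
  then show "nat \<lceil>q ^ \<kappa> n\<rceil> \<le> n" by (simp add: ceiling_le_iff nat_le_iff)
  have "real n \<le> q ^ Suc (\<kappa> n)"
    using *(2) n q by (simp only: log_le_iff powr_realpow)
  then show "n \<le> nat \<lceil>q ^ Suc (\<kappa> n)\<rceil>" by linarith
qed

text \<open>For \<open>n\<close> between \<open>a k\<close> and \<open>a (k + 1)\<close>,
  monotonicity squeezes \<open>T n / n\<close> between \<open>T (a k) / a (k + 1)\<close> and
  \<open>T (a (k + 1)) / a k\<close>. Each differs from an average along the subsequence by a ratio
  of neighbouring \<open>a\<close>, hence the limits \<open>c / q\<close> and
  \<open>c * q\<close>.\<close>

lemma mono_average_bounds:
  fixes T :: "nat \<Rightarrow> real"
  assumes "mono T" and nonneg: "\<And>n. 0 \<le> T n"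
    and lim: "(\<lambda>k. T (nat \<lceil>q ^ k\<rceil>) / real (nat \<lceil>q ^ k\<rceil>)) \<longlonglongrightarrow> c"
  shows "y > c * q \<Longrightarrow> \<forall>\<^sub>F n in sequentially. T n / real n < y"
    and "y < c / q \<Longrightarrow> \<forall>\<^sub>F n in sequentially. y < T n / real n"
proof -
  define a where "a k = nat \<lceil>q ^ k\<rceil>" for k
  have a_pos: "a k > 0" for k
    using q by (simp add: a_def)
  obtain \<kappa> where \<kappa>: "filterlim \<kappa> at_top at_top"
    and lo: "\<And>n. n > 0 \<Longrightarrow> a (\<kappa> n) \<le> n" and hi: "\<And>n. n > 0 \<Longrightarrow> n \<le> a (Suc (\<kappa> n))"
    using exists_power_bracket unfolding a_def by metis
  have lim: "(\<lambda>k. T (a k) / real (a k)) \<longlonglongrightarrow> c"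
    and ratio: "(\<lambda>k. real (a (Suc k)) / real (a k)) \<longlonglongrightarrow> q"
    using assms(3) ratio_ceiling_power_tendsto by (simp_all add: a_def)
  \<comment> \<open>The factor \<open>a (Suc k)\<close> cancels; composing with
    \<open>\<kappa>\<close> then turns a limit in \<open>k\<close> into one in
    \<open>n\<close>.\<close>
  have "(\<lambda>k. T (a (Suc k)) / real (a (Suc k)) * (real (a (Suc k)) / real (a k))) \<longlonglongrightarrow> c * q"
    by (intro tendsto_mult ratio LIMSEQ_Suc[OF lim])
  then have up: "(\<lambda>n. T (a (Suc (\<kappa> n))) / real (a (\<kappa> n))) \<longlonglongrightarrow> c * q"
    using a_pos by (auto intro: filterlim_compose[OF _ \<kappa>] simp: less_imp_neq[symmetric])
  have "(\<lambda>k. T (a k) / real (a k) / (real (a (Suc k)) / real (a k))) \<longlonglongrightarrow> c / q"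
    using q by (intro tendsto_divide ratio lim) auto
  then have down: "(\<lambda>n. T (a (\<kappa> n)) / real (a (Suc (\<kappa> n)))) \<longlonglongrightarrow> c / q"
    using a_pos by (auto intro: filterlim_compose[OF _ \<kappa>] simp: less_imp_neq[symmetric])
  show "\<forall>\<^sub>F n in sequentially. T n / real n < y" if "y > c * q"
    using order_tendstoD(2)[OF up that] eventually_gt_at_top[of 0]
  proof eventually_elim
    case (elim n)
    have "T n / real n \<le> T (a (Suc (\<kappa> n))) / real (a (\<kappa> n))"
      using elim a_pos lo hi nonneg monoD[OF \<open>mono T\<close>] by (intro frac_le) auto
    with elim show ?case by linarith
  qed
  show "\<forall>\<^sub>F n in sequentially. y < T n / real n" if "y < c / q"
    using order_tendstoD(1)[OF down that] eventually_gt_at_top[of 0]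
  proof eventually_elim
    case (elim n)
    have "T (a (\<kappa> n)) / real (a (Suc (\<kappa> n))) \<le> T n / real n"
      using elim a_pos lo hi nonneg monoD[OF \<open>mono T\<close>] by (intro frac_le) auto
    with elim show ?case by linarith
  qed
qed

end

text \<open>For a fixed ratio the averages are only confined to a neighbourhood of
  \<open>[c / q m, c * q m]\<close>. Any \<open>y \<noteq> c\<close> lies outside this interval once
  \<open>q m\<close> is close enough to 1.\<close>

lemma mono_average_tendsto:
  fixes T :: "nat \<Rightarrow> real" and q :: "nat \<Rightarrow> real"
  assumes T: "mono T" "\<And>n. 0 \<le> T n" and q: "\<And>m. q m > 1" "q \<longlonglongrightarrow> 1"
    and lim: "\<And>m. (\<lambda>k. T (nat \<lceil>q m ^ k\<rceil>) / real (nat \<lceil>q m ^ k\<rceil>)) \<longlonglongrightarrow> c"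
  shows "(\<lambda>n. T n / real n) \<longlonglongrightarrow> c"
proof (rule order_tendstoI)
  fix y assume "y < c"
  moreover have "(\<lambda>m. c / q m) \<longlonglongrightarrow> c / 1"
    by (intro tendsto_intros q) auto
  ultimately obtain m where "y < c / q m"
    using order_tendstoD(1)[of "\<lambda>m. c / q m" c sequentially y]
    by (auto simp: eventually_sequentially)
  then show "\<forall>\<^sub>F n in sequentially. y < T n / real n"
    by (rule mono_average_bounds(2)[OF q(1) T lim])
next
  fix y assume "c < y"
  moreover have "(\<lambda>m. c * q m) \<longlonglongrightarrow> c * 1"
    by (intro tendsto_intros q)
  ultimately obtain m where "c * q m < y"
    using order_tendstoD(2)[of "\<lambda>m. c * q m" c sequentially y]
    by (auto simp: eventually_sequentially)
  then show "\<forall>\<^sub>F n in sequentially. T n / real n < y"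
    by (rule mono_average_bounds(1)[OF q(1) T lim])
qed

section \<open>Summability along the subsequence\<close>

text \<open>On a geometric scale \<open>ln n\<close> is of order \<open>k\<close> and
  \<open>ln (ln n)\<close> of order \<open>ln k\<close>, so the bound divided by the square of
  \<open>n\<close> becomes the logarithmic series that converges for
  \<open>\<gamma> > 1\<close>.\<close>

lemma summable_along_ceiling_power:
  fixes C :: "nat \<Rightarrow> real" and q \<gamma> :: real
  assumes q: "q > 1" and \<gamma>: "\<gamma> > 1"
    and C: "C \<in> O(\<lambda>n. (real n)\<^sup>2 / (ln (real n) * ln (ln (real n)) powr \<gamma>))"
  shows "summable (\<lambda>k. C (nat \<lceil>q ^ k\<rceil>) / (real (nat \<lceil>q ^ k\<rceil>))\<^sup>2)"
proof (rule summable_comparison_test_bigo)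
  define a where "a k = nat \<lceil>q ^ k\<rceil>" for k
  define g where "g x = 1 / (ln x * ln (ln x) powr \<gamma>)" for x :: real
  have a_ge: "q ^ k \<le> real (a k)" for k
    unfolding a_def by linarith
  have a_pos: "a k > 0" for k
    using q by (simp add: a_def)
  have a_lim: "filterlim a at_top at_top"
    unfolding a_def using q by real_asymp
  have "(\<lambda>k. C (a k)) \<in> O(\<lambda>k. (real (a k))\<^sup>2 * g (real (a k)))"
    using landau_o.big.compose[OF C a_lim] by (simp add: g_def)
  then have "(\<lambda>k. C (a k) / (real (a k))\<^sup>2) \<in> O(\<lambda>k. g (real (a k)))"
    using a_pos by (subst (asm) mult.commute, subst landau_o.big.divide_eq2)
      (auto simp: mult.commute less_imp_neq[symmetric])
  also have "(\<lambda>k. g (real (a k))) \<in> O(\<lambda>k. g (q ^ k))"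
  proof (rule landau_o.big_mono)
    \<comment> \<open>Beyond \<open>exp 1\<close> the iterated logarithm is positive and
      \<open>g\<close> is decreasing, so the rounded argument may be replaced by the smaller
      \<open>q ^ k\<close>.\<close>
    have "\<forall>\<^sub>F k in sequentially. q ^ k > exp 1" using q by real_asymp
    then show "\<forall>\<^sub>F k in sequentially. norm (g (real (a k))) \<le> norm (g (q ^ k))"
    proof eventually_elim
      case (elim k)
      have 1: "1 < ln (q ^ k)"
        using elim ln_less_cancel_iff[of "exp 1" "q ^ k"] by (simp add: less_trans[OF exp_gt_zero])
      moreover have "ln (q ^ k) \<le> ln (real (a k))"
        using a_ge[of k] q a_pos[of k] by simp
      ultimately show ?case
        using \<gamma> unfolding g_def
        by (auto intro!: divide_left_mono mult_mono powr_mono2 mult_pos_pos simp: abs_mult)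
    qed
  qed
  also have "(\<lambda>k. g (q ^ k)) \<in> O(\<lambda>k. 1 / (real k * ln (real k + 1) powr \<gamma>))"
    unfolding g_def using q \<gamma> by real_asymp
  finally show "(\<lambda>k. C (nat \<lceil>q ^ k\<rceil>) / (real (nat \<lceil>q ^ k\<rceil>))\<^sup>2)
      \<in> O(\<lambda>k. 1 / (real k * ln (real k + 1) powr \<gamma>))"
    by (simp add: a_def)
  show "summable (\<lambda>k. norm (1 / (real k * ln (real k + 1) powr \<gamma>)))"
    using summable_inverse_mult_ln_powr[OF \<gamma>] by simp
qed

lemma summable_inverse_ceiling_power:
  fixes q :: real
  assumes "q > 1"
  shows "summable (\<lambda>k. 1 / real (nat \<lceil>q ^ k\<rceil>))"
proof (rule summable_comparison_test')
  show "summable (\<lambda>k. (1 / q) ^ k)"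
    using assms by (intro summable_geometric) auto
  fix k :: nat
  have "q ^ k \<le> real (nat \<lceil>q ^ k\<rceil>)" "0 < q ^ k" using assms by (linarith, simp)
  then show "norm (1 / real (nat \<lceil>q ^ k\<rceil>)) \<le> (1 / q) ^ k"
    by (simp add: power_divide frac_le)
qed

section \<open>Second moment of the centred sum\<close>

lemma (in prob_space) integrable_mult_of_square:
  fixes X Y :: "'a \<Rightarrow> real"
  assumes [measurable]: "X \<in> borel_measurable M" "Y \<in> borel_measurable M"
    and "integrable M (\<lambda>x. (X x)\<^sup>2)" "integrable M (\<lambda>x. (Y x)\<^sup>2)"
  shows "integrable M (\<lambda>x. X x * Y x)"
proof (rule Bochner_Integration.integrable_bound)
  show "integrable M (\<lambda>x. (X x)\<^sup>2 + (Y x)\<^sup>2)" using assms by simp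
  have "\<bar>s * t\<bar> \<le> s\<^sup>2 + t\<^sup>2" for s t :: real
  proof -
    have "2 * (\<bar>s\<bar> * \<bar>t\<bar>) \<le> s\<^sup>2 + t\<^sup>2" "0 \<le> \<bar>s\<bar> * \<bar>t\<bar>"
      using sum_squares_bound[of "\<bar>s\<bar>" "\<bar>t\<bar>"] by simp_all
    then show ?thesis unfolding abs_mult by linarith
  qed
  then show "AE x in M. norm (X x * Y x) \<le> norm ((X x)\<^sup>2 + (Y x)\<^sup>2)"
    by simp
qed simp

lemma (in prob_space) expectation_square_centered_sum:
  fixes X :: "nat \<Rightarrow> 'a \<Rightarrow> real"
  assumes [measurable]: "\<And>i. i \<ge> 1 \<Longrightarrow> X i \<in> borel_measurable M"
    and sq: "\<And>i. i \<ge> 1 \<Longrightarrow> integrable M (\<lambda>x. (X i x)\<^sup>2)"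
    and mean: "\<And>i. i \<ge> 1 \<Longrightarrow> expectation (X i) = \<mu>"
  shows "integrable M (\<lambda>x. ((\<Sum>i = 1..n. X i x) - real n * \<mu>)\<^sup>2)"
    and "expectation (\<lambda>x. ((\<Sum>i = 1..n. X i x) - real n * \<mu>)\<^sup>2)
      = (\<Sum>i = 1..n. variance (X i)) + 2 * (\<Sum>(i, j) \<in> {(i, j). 1 \<le> i \<and> i < j \<and> j \<le> n}.
          expectation (\<lambda>x. X i x * X j x) - \<mu>\<^sup>2)"
proof -
  have int: "integrable M (X i)" if "i \<ge> 1" for i
    using that sq by (auto intro: square_integrable_imp_integrable[of "X i"])
  have intprod: "integrable M (\<lambda>x. X i x * X j x)" if "i \<ge> 1" "j \<ge> 1" for i j
    using that by (auto intro!: integrable_mult_of_square[of "X i" "X j"] sq)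
  have cross_eq: "(\<lambda>x. (X i x - \<mu>) * (X j x - \<mu>))
      = (\<lambda>x. X i x * X j x - \<mu> * X i x - \<mu> * X j x + \<mu>\<^sup>2)" for i j
    by (simp add: fun_eq_iff algebra_simps power2_eq_square)
  have cross_int: "integrable M (\<lambda>x. (X i x - \<mu>) * (X j x - \<mu>))" if "i \<ge> 1" "j \<ge> 1" for i j
    unfolding cross_eq using that int intprod by simp
  have cross: "expectation (\<lambda>x. (X i x - \<mu>) * (X j x - \<mu>))
      = expectation (\<lambda>x. X i x * X j x) - \<mu>\<^sup>2" if "i \<ge> 1" "j \<ge> 1" for i j
    unfolding cross_eq using that int intprod mean
    by (simp add: prob_space power2_eq_square)
  have sq_int: "integrable M (\<lambda>x. (X i x - \<mu>)\<^sup>2)" if "i \<ge> 1" for i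
    using cross_int[OF that that] by (simp add: power2_eq_square)
  let ?D = "{(i, j). 1 \<le> i \<and> i < j \<and> j \<le> n}"
  \<comment> \<open>The algebraic identity is applied pointwise to the centred variables
    \<open>X i - \<mu>\<close>: its diagonal gives variances, its strict pairs give
    covariances.\<close>
  have eq: "(\<lambda>x. ((\<Sum>i = 1..n. X i x) - real n * \<mu>)\<^sup>2)
      = (\<lambda>x. (\<Sum>i = 1..n. (X i x - \<mu>)\<^sup>2) + 2 * (\<Sum>p\<in>?D. (X (fst p) x - \<mu>) * (X (snd p) x - \<mu>)))"
    using square_sum_eq_strict_pairs[of "\<lambda>i. X i _ - \<mu>" n]
    by (simp add: fun_eq_iff sum_subtractf case_prod_beta)
  have ints: "integrable M (\<lambda>x. \<Sum>i = 1..n. (X i x - \<mu>)\<^sup>2)"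
    "integrable M (\<lambda>x. \<Sum>p\<in>?D. (X (fst p) x - \<mu>) * (X (snd p) x - \<mu>))"
    by (auto intro!: Bochner_Integration.integrable_sum sq_int cross_int)
  show "integrable M (\<lambda>x. ((\<Sum>i = 1..n. X i x) - real n * \<mu>)\<^sup>2)"
    unfolding eq using ints by simp
  have "expectation (\<lambda>x. ((\<Sum>i = 1..n. X i x) - real n * \<mu>)\<^sup>2)
      = expectation (\<lambda>x. \<Sum>i = 1..n. (X i x - \<mu>)\<^sup>2)
        + 2 * expectation (\<lambda>x. \<Sum>p\<in>?D. (X (fst p) x - \<mu>) * (X (snd p) x - \<mu>))"
    unfolding eq using ints by simp
  also have "expectation (\<lambda>x. \<Sum>i = 1..n. (X i x - \<mu>)\<^sup>2) = (\<Sum>i = 1..n. variance (X i))"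
    using mean by (subst Bochner_Integration.integral_sum) (auto intro!: sq_int sum.cong)
  also have "expectation (\<lambda>x. \<Sum>p\<in>?D. (X (fst p) x - \<mu>) * (X (snd p) x - \<mu>))
      = (\<Sum>p\<in>?D. expectation (\<lambda>x. X (fst p) x * X (snd p) x) - \<mu>\<^sup>2)"
    by (subst Bochner_Integration.integral_sum) (auto intro!: cross_int sum.cong simp: cross)
  finally show "expectation (\<lambda>x. ((\<Sum>i = 1..n. X i x) - real n * \<mu>)\<^sup>2)
      = (\<Sum>i = 1..n. variance (X i)) + 2 * (\<Sum>(i, j) \<in> ?D. expectation (\<lambda>x. X i x * X j x) - \<mu>\<^sup>2)"
    by (simp add: case_prod_beta)
qed

section \<open>The strong law from the subsequences\<close>

theorem corollary1:
  fixes P :: "'a measure" and X :: "nat \<Rightarrow> 'a \<Rightarrow> real" and \<mu> M \<gamma> :: real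
  assumes "prob_space P"
    and "\<And>i. i \<ge> 1 \<Longrightarrow> X i \<in> borel_measurable P"
    and "\<And>i j. i \<ge> 1 \<Longrightarrow> j \<ge> 1 \<Longrightarrow> distr P borel (X i) = distr P borel (X j)"
    and "\<And>i. i \<ge> 1 \<Longrightarrow> integrable P (\<lambda>\<omega>. (X i \<omega>)\<^sup>2)"
    and "\<And>i. i \<ge> 1 \<Longrightarrow> prob_space.expectation P (X i) = \<mu>"
    and "M > 0"
    and "\<And>i. i \<ge> 1 \<Longrightarrow> AE \<omega> in P. X i \<omega> \<ge> - M"
    and "\<gamma> > 1"
    and "(\<lambda>n::nat. \<Sum>(i, j) \<in> {(i, j). 1 \<le> i \<and> i < j \<and> j \<le> n}.
            (prob_space.expectation P (\<lambda>\<omega>. X i \<omega> * X j \<omega>) - \<mu>\<^sup>2))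
         \<in> O(\<lambda>n. (real n)\<^sup>2 / (ln (real n) * ln (ln (real n)) powr \<gamma>))"
  shows "AE \<omega> in P. (\<lambda>n. (\<Sum>i = 1..n. X i \<omega>) / real n) \<longlonglongrightarrow> \<mu>"
proof -
  interpret prob_space P by fact
  define q where "q m = 1 + 1 / real (Suc m)" for m
  have q_gt: "q m > 1" for m by (simp add: q_def)
  have q_lim: "q \<longlonglongrightarrow> 1" unfolding q_def by real_asymp
  define S where "S n \<omega> = (\<Sum>i = 1..n. X i \<omega>)" for n \<omega>
  define C where "C n = (\<Sum>(i, j) \<in> {(i, j). 1 \<le> i \<and> i < j \<and> j \<le> n}.
      expectation (\<lambda>\<omega>. X i \<omega> * X j \<omega>) - \<mu>\<^sup>2)" for n
  have var_eq: "variance (X i) = variance (X 1)" if "i \<ge> 1" for i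
  proof -
    \<comment> \<open>Written as an integral against the law of \<open>X i\<close>, the variance
      depends only on that law, which is common to all indices.\<close>
    have "variance (X i) = (\<integral>x. (x - \<mu>)\<^sup>2 \<partial>distr P borel (X i))" if "i \<ge> 1" for i
      using that assms(2,5) by (subst integral_distr) auto
    then show ?thesis using that assms(3)[of i 1] by simp
  qed
  have integrable: "integrable P (\<lambda>\<omega>. (S n \<omega> - real n * \<mu>)\<^sup>2)" for n
    unfolding S_def by (rule expectation_square_centered_sum(1)[OF assms(2,4,5)])
  have second_moment: "expectation (\<lambda>\<omega>. (S n \<omega> - real n * \<mu>)\<^sup>2)
      = real n * variance (X 1) + 2 * C n" for n
  proof -
    have "(\<Sum>i = 1..n. variance (X i)) = (\<Sum>i = 1..n. variance (X 1))"
      by (rule sum.cong[OF refl], rule var_eq) simp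
    then show ?thesis
      unfolding S_def C_def by (subst expectation_square_centered_sum(2)[OF assms(2,4,5)]) auto
  qed
  have "AE \<omega> in P. (\<lambda>k. S (nat \<lceil>q m ^ k\<rceil>) \<omega> / real (nat \<lceil>q m ^ k\<rceil>)) \<longlonglongrightarrow> \<mu>" for m
  proof -
    define a where "a k = nat \<lceil>q m ^ k\<rceil>" for k
    have a_pos: "a k > 0" for k
      using q_gt[of m] by (simp add: a_def less_trans[OF zero_less_one])
    \<comment> \<open>These are the variances of \<open>S (a k) / a k\<close>: the diagonal part
      decays geometrically, the covariance part is controlled by the growth hypothesis.\<close>
    have "summable (\<lambda>k. variance (X 1) * (1 / real (a k)) + 2 * (C (a k) / (real (a k))\<^sup>2))"
      unfolding a_def C_def
      by (intro summable_add summable_mult summable_inverse_ceiling_power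
          summable_along_ceiling_power[OF q_gt assms(8,9)] q_gt)
    also have "(\<lambda>k. variance (X 1) * (1 / real (a k)) + 2 * (C (a k) / (real (a k))\<^sup>2))
        = (\<lambda>k. expectation (\<lambda>\<omega>. (S (a k) \<omega> - real (a k) * \<mu>)\<^sup>2 / (real (a k))\<^sup>2))"
    proof
      fix k
      have "v * (1 / r) + 2 * (c / r\<^sup>2) = (r * v + 2 * c) / r\<^sup>2" if "r > 0" for v c r :: real
        using that by (simp add: field_simps power2_eq_square)
      then show "variance (X 1) * (1 / real (a k)) + 2 * (C (a k) / (real (a k))\<^sup>2)
          = expectation (\<lambda>\<omega>. (S (a k) \<omega> - real (a k) * \<mu>)\<^sup>2 / (real (a k))\<^sup>2)"
        using a_pos[of k] by (subst integral_divide_zero) (simp only: second_moment of_nat_0_less_iff)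
    qed
    finally have "AE \<omega> in P. (\<lambda>k. (S (a k) \<omega> - real (a k) * \<mu>)\<^sup>2 / (real (a k))\<^sup>2) \<longlonglongrightarrow> 0"
      using integrable by (intro AE_tendsto_0_of_summable_integral) auto
    then show ?thesis
    proof eventually_elim
      case (elim \<omega>)
      then have "(\<lambda>k. (S (a k) \<omega> / real (a k) - \<mu>)\<^sup>2) \<longlonglongrightarrow> 0"
        using a_pos by (simp add: power_divide[symmetric] diff_divide_distrib)
      from tendsto_real_sqrt[OF this] have "(\<lambda>k. S (a k) \<omega> / real (a k) - \<mu>) \<longlonglongrightarrow> 0"
        by (simp add: tendsto_rabs_zero_iff)
      then show ?case
        by (simp add: LIM_zero_iff a_def)
    qed
  qed
  \<comment> \<open>Only countably many ratios occur, so one null set serves for all of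
    them.\<close>
  then have "AE \<omega> in P. \<forall>m. (\<lambda>k. S (nat \<lceil>q m ^ k\<rceil>) \<omega> / real (nat \<lceil>q m ^ k\<rceil>)) \<longlonglongrightarrow> \<mu>"
    by (simp add: AE_all_countable)
  moreover have "AE \<omega> in P. \<forall>i. X (Suc i) \<omega> \<ge> - M"
    using assms(7) by (simp add: AE_all_countable)
  ultimately show ?thesis
  proof eventually_elim
    case (elim \<omega>)
    \<comment> \<open>The lower bound makes every increment \<open>X (Suc n) + M\<close>
      nonnegative; the shift moves the limit of the averages from \<open>\<mu>\<close> to
      \<open>\<mu> + M\<close>.\<close>
    define T where "T n = S n \<omega> + real n * M" for n
    have T_Suc: "T (Suc n) = T n + (X (Suc n) \<omega> + M)" for n
      by (simp add: T_def S_def algebra_simps)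
    have "mono T"
      using elim(2) by (intro incseq_SucI) (simp add: T_Suc, smt (verit))
    moreover from this have "0 \<le> T n" for n
      using monoD[of T 0 n] by (simp add: T_def S_def)
    moreover have "(\<lambda>k. T (nat \<lceil>q m ^ k\<rceil>) / real (nat \<lceil>q m ^ k\<rceil>)) \<longlonglongrightarrow> \<mu> + M" for m
    proof -
      have "0 < real (nat \<lceil>q m ^ k\<rceil>)" for k
        using q_gt[of m] by (simp add: less_trans[OF zero_less_one])
      then have "real (nat \<lceil>q m ^ k\<rceil>) \<noteq> 0" for k
        by (metis less_irrefl)
      then show ?thesis
        using tendsto_add[OF elim(1)[rule_format, of m] tendsto_const[of M]]
        by (simp add: T_def add_divide_distrib del: of_nat_eq_0_iff)
    qed
    ultimately have "(\<lambda>n. T n / real n) \<longlonglongrightarrow> \<mu> + M"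
      by (intro mono_average_tendsto[OF _ _ q_gt q_lim])
    from tendsto_diff[OF this tendsto_const[of M]] have "(\<lambda>n. T n / real n - M) \<longlonglongrightarrow> \<mu>"
      by simp
    \<comment> \<open>The two sequences agree only for \<open>n > 0\<close>: at 0, where division by
      zero yields 0, one is \<open>- M\<close> and the other 0.\<close>
    then show ?case
      by (rule Lim_transform_eventually, use eventually_gt_at_top[of 0] in eventually_elim)
        (simp add: T_def S_def add_divide_distrib)
  qed
qed

end
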